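(* Let $\alpha,\beta,\gamma,\delta\in\mathbb{C}$, $p_1(z)=\gamma+\delta z$ and $p_2(z)=(\alpha+\beta z)(\gamma+\delta z)$. Assume that $|p_1(z)|^2+|p_2(z)|\le 1$ for all $z\in\mathbb{T}$. If either $\alpha\beta\gamma\delta=0$, or $\arg(\alpha)-\arg(\beta)=\arg(\gamma)-\arg(\delta)$ (mod $2\pi$), then there exists a holomorphic function $q$ on the bidisc $\mathbb{D}^2$ with $q^{(k)}(0)=0$ for all multi-indices $|k|\le 2$ such that $\|p+q\|_{\mathbb{D}^2,\infty}\le 1$, where \[p(z_1,z_2)=\gamma z_1+\delta z_2+\alpha\gamma z_1^2+(\alpha\delta+\beta\gamma)z_1z_2+\beta\delta z_2^2.\]
   Context: $\mathbb{D}$ is the open unit disc, $\mathbb{T}$ the unit circle; $\|g\|_{\mathbb{D}^2,\infty}=\sup_{\mathbb{D}^2}|g|$; $q^{(k)}$ is the partial derivative of multi-index $k$. The polynomial $p$ is the one attached to $(p_1,p_2)$ by the correspondence $p=a_{10}z_1+a_{01}z_2+a_{20}z_1^2+a_{11}z_1z_2+a_{02}z_2^2\leftrightarrow p_1(z)=a_{10}+a_{01}z,\ p_2(z)=a_{20}+a_{11}z+a_{02}z^2$. *)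

theory Defs
  imports "HOL-Complex_Analysis.Complex_Analysis" "HOL-Library.Real_Mod"
begin

definition bidisc :: "(complex \<times> complex) set" where
  "bidisc = ball 0 1 \<times> ball 0 1"

(* Complex differentiability in two variables: at every point the Frechet derivative
   exists and is complex linear, i.e. of the form (u, v) |-> a u + b v. *)
definition holomorphic2_on ::
    "(complex \<times> complex \<Rightarrow> complex) \<Rightarrow> (complex \<times> complex) set \<Rightarrow> bool" where
  "holomorphic2_on f U \<longleftrightarrow>
     (\<forall>z\<in>U. \<exists>a b. (f has_derivative (\<lambda>(u, v). a * u + b * v)) (at z within U))"

definition partial1 ::
    "(complex \<times> complex \<Rightarrow> complex) \<Rightarrow> complex \<times> complex \<Rightarrow> complex" where
  "partial1 f = (\<lambda>(z1, z2). deriv (\<lambda>w. f (w, z2)) z1)"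

definition partial2 ::
    "(complex \<times> complex \<Rightarrow> complex) \<Rightarrow> complex \<times> complex \<Rightarrow> complex" where
  "partial2 f = (\<lambda>(z1, z2). deriv (\<lambda>w. f (z1, w)) z2)"

definition partial_deriv ::
    "nat \<times> nat \<Rightarrow> (complex \<times> complex \<Rightarrow> complex) \<Rightarrow> complex \<times> complex \<Rightarrow> complex" where
  "partial_deriv k f = (partial1 ^^ fst k) ((partial2 ^^ snd k) f)"

(* Extended-real valued, so that unbounded functions have norm infinity
   (a real-valued Sup of an unbounded set would be unspecified). *)
definition bidisc_sup_norm :: "(complex \<times> complex \<Rightarrow> complex) \<Rightarrow> ereal" where
  "bidisc_sup_norm g = (SUP z\<in>bidisc. ereal (cmod (g z)))"

end

theory Submission
  imports Defs
begin

text \<open>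
  Write \<open>L\<^sub>1 = \<gamma> z\<^sub>1 + \<delta> z\<^sub>2\<close> and \<open>L\<^sub>2 = \<alpha> z\<^sub>1 + \<beta> z\<^sub>2\<close>, so that \<open>p = L\<^sub>1 (1 + L\<^sub>2)\<close>, and put
  \<open>s = \<bar>\<gamma>\<bar> + \<bar>\<delta>\<bar>\<close> and \<open>t = \<bar>\<alpha>\<bar> + \<bar>\<beta>\<bar>\<close>; these are the suprema of \<open>\<bar>L\<^sub>1\<bar>\<close> and \<open>\<bar>L\<^sub>2\<bar>\<close> on the bidisc.

  For nonzero coefficients the condition on the arguments says that one point \<open>z\<close> of the circle
  attains both \<open>\<bar>\<gamma> + \<delta> z\<bar> = s\<close> and \<open>\<bar>\<alpha> + \<beta> z\<bar> = t\<close>. If one of the four coefficients vanishes, such a point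
  exists as well, because one of the two moduli is then constant on the circle. So in every case
  the hypothesis at this single point yields \<open>s\<^sup>2 + s t \<le> 1\<close> (lemma \<open>aligned_point_exists\<close>).

  This is the coefficient condition of the one-variable Caratheodory--Fejer problem, and a
  Moebius map solves it: if \<open>s < 1\<close> and \<open>d = 1 - s\<^sup>2\<close>, the function \<open>h w = (d + w) / (d + s\<^sup>2 w)\<close> has
  the expansion \<open>1 + w + O(w\<^sup>2)\<close> and satisfies \<open>s \<bar>h w\<bar> \<le> 1\<close> as long as \<open>s \<bar>w\<bar> \<le> d\<close>
  (lemma \<open>moebius_bound\<close>), hence for \<open>w = L\<^sub>2\<close>. Therefore \<open>L\<^sub>1 h(L\<^sub>2)\<close> is bounded by \<open>1\<close> on the
  bidisc, and it differs from \<open>p\<close> by \<open>q = L\<^sub>1 L\<^sub>2\<^sup>2 r(L\<^sub>2)\<close>, where \<open>r w = - s\<^sup>2 / (d + s\<^sup>2 w)\<close>.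
  Functions of this shape vanish to third order at the origin.
\<close>

section \<open>Corrections of the form \<open>L\<^sub>1 L\<^sub>2\<^sup>2 r(L\<^sub>2)\<close>\<close>

definition cubic_term ::
  "complex \<Rightarrow> complex \<Rightarrow> complex \<Rightarrow> complex \<Rightarrow> (complex \<Rightarrow> complex) \<Rightarrow> complex \<times> complex \<Rightarrow> complex" where
  "cubic_term \<alpha> \<beta> \<gamma> \<delta> r =
     (\<lambda>(z1, z2). (\<gamma> * z1 + \<delta> * z2) * (\<alpha> * z1 + \<beta> * z2)\<^sup>2 * r (\<alpha> * z1 + \<beta> * z2))"

lemma holomorphic2_on_cubic_term:
  assumes r: "r holomorphic_on S" "open S"
    and S: "\<And>z1 z2. (z1, z2) \<in> U \<Longrightarrow> \<alpha> * z1 + \<beta> * z2 \<in> S"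
  shows "holomorphic2_on (cubic_term \<alpha> \<beta> \<gamma> \<delta> r) U"
  unfolding holomorphic2_on_def
proof
  fix z assume z: "z \<in> U"
  define L1 where "L1 = (\<lambda>z. \<gamma> * fst z + \<delta> * snd z)"
  define L2 where "L2 = (\<lambda>z. \<alpha> * fst z + \<beta> * snd z)"
  have L2S: "L2 z \<in> S"
    using S[of "fst z" "snd z"] z by (simp add: L2_def)
  have dL1: "(L1 has_derivative L1) (at z within U)"
    unfolding L1_def by (intro derivative_eq_intros refl) auto
  have dL2: "(L2 has_derivative L2) (at z within U)"
    unfolding L2_def by (intro derivative_eq_intros refl) auto
  have "(r has_field_derivative deriv r (L2 z)) (at (L2 z) within L2 ` U)"
    using r L2S by (meson holomorphic_derivI has_field_derivative_at_within)
  then have dr: "((\<lambda>x. r (L2 x)) has_derivative (\<lambda>h. deriv r (L2 z) * L2 h)) (at z within U)"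
    using has_derivative_in_compose[OF dL2] by (simp add: has_field_derivative_def)
  have "((\<lambda>x. L1 x * (L2 x)\<^sup>2 * r (L2 x)) has_derivative
      (\<lambda>h. L1 z * (L2 z)\<^sup>2 * (deriv r (L2 z) * L2 h)
         + (L1 z * (2 * L2 z * L2 h) + L1 h * (L2 z)\<^sup>2) * r (L2 z))) (at z within U)"
    by (rule derivative_eq_intros dL1 dL2 dr refl)+ (simp add: mult_ac)
  also have "(\<lambda>x. L1 x * (L2 x)\<^sup>2 * r (L2 x)) = cubic_term \<alpha> \<beta> \<gamma> \<delta> r"
    by (auto simp: cubic_term_def L1_def L2_def)
  also have "(\<lambda>h. L1 z * (L2 z)\<^sup>2 * (deriv r (L2 z) * L2 h)
         + (L1 z * (2 * L2 z * L2 h) + L1 h * (L2 z)\<^sup>2) * r (L2 z))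
     = (\<lambda>(u, v).
          (L1 z * (L2 z)\<^sup>2 * deriv r (L2 z) * \<alpha> + (2 * L1 z * L2 z * \<alpha> + \<gamma> * (L2 z)\<^sup>2) * r (L2 z)) * u
        + (L1 z * (L2 z)\<^sup>2 * deriv r (L2 z) * \<beta> + (2 * L1 z * L2 z * \<beta> + \<delta> * (L2 z)\<^sup>2) * r (L2 z)) * v)"
    unfolding L1_def L2_def by (auto simp: fun_eq_iff algebra_simps)
  finally show "\<exists>a b. (cubic_term \<alpha> \<beta> \<gamma> \<delta> r has_derivative (\<lambda>(u, v). a * u + b * v)) (at z within U)"
    by blast
qed

text \<open>Both partial derivatives of a correction term are instances of this derivative along a
  coordinate line. Its right-hand side still contains the factor \<open>L\<^sub>2\<close>, multiplied by a function
  that vanishes at the origin, which is why a second differentiation also gives zero there.\<close>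

lemma deriv_cubic_along_line:
  fixes a b c e :: complex
  assumes r: "r holomorphic_on S" "open S" and S: "a + b * w \<in> S"
  shows "deriv (\<lambda>w. (c + e * w) * (a + b * w)\<^sup>2 * r (a + b * w)) w =
    (a + b * w) * (e * (a + b * w) * r (a + b * w) + 2 * b * (c + e * w) * r (a + b * w)
       + b * (c + e * w) * (a + b * w) * deriv r (a + b * w))"
proof -
  have dr: "((\<lambda>w. r (a + b * w)) has_field_derivative deriv r (a + b * w) * b) (at w)"
    by (rule DERIV_chain2[where f = r]) (use r S in \<open>auto intro!: holomorphic_derivI derivative_eq_intros\<close>)
  show ?thesis
    by (rule DERIV_imp_deriv) (rule derivative_eq_intros dr refl | simp add: algebra_simps power2_eq_square)+
qed

lemma deriv_quadratic_along_line_0: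
  fixes a c e1 e2 :: complex
  assumes r: "r holomorphic_on S" "open S" "0 \<in> S"
  shows "deriv (\<lambda>w. (a * w) * (e1 * (a * w) * r (a * w) + e2 * (c * w) * r (a * w)
       + b * (c * w) * (a * w) * deriv r (a * w))) 0 = 0"
proof -
  have r': "(deriv r) holomorphic_on S"
    using r by (simp add: holomorphic_deriv)
  have comp: "((\<lambda>w. f (a * w)) has_field_derivative deriv f 0 * a) (at 0)"
    if "f holomorphic_on S" for f
    by (rule DERIV_chain2[where f = f]) (use that r in \<open>auto intro!: holomorphic_derivI derivative_eq_intros\<close>)
  show ?thesis
    by (rule DERIV_imp_deriv)
       (rule derivative_eq_intros comp[OF r(1)] comp[OF r'] refl | simp)+
qed

text \<open>The formulas for the first partial derivatives hold only where \<open>L\<^sub>2\<close> lies in the domain of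
  \<open>r\<close>. This is a neighbourhood of the origin, and a second derivative at the origin depends on
  nothing else.\<close>

lemma partial_deriv_cubic_term_0:
  assumes r: "r holomorphic_on S" "open S" "0 \<in> S" and k: "fst k + snd k \<le> 2"
  shows "partial_deriv k (cubic_term \<alpha> \<beta> \<gamma> \<delta> r) (0, 0) = 0"
proof -
  let ?q = "cubic_term \<alpha> \<beta> \<gamma> \<delta> r"
  have near_0: "\<forall>\<^sub>F w in nhds 0. a * w \<in> S" for a :: complex
  proof -
    have "open ((\<lambda>w. a * w) -` S)"
      by (intro open_vimage r continuous_intros)
    then show ?thesis
      using eventually_nhds_in_open[of "(\<lambda>w. a * w) -` S" 0] r by simp
  qed
  have p1: "partial1 ?q (z1, z2) =
      (\<beta> * z2 + \<alpha> * z1) * (\<gamma> * (\<beta> * z2 + \<alpha> * z1) * r (\<beta> * z2 + \<alpha> * z1)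
       + 2 * \<alpha> * (\<delta> * z2 + \<gamma> * z1) * r (\<beta> * z2 + \<alpha> * z1)
       + \<alpha> * (\<delta> * z2 + \<gamma> * z1) * (\<beta> * z2 + \<alpha> * z1) * deriv r (\<beta> * z2 + \<alpha> * z1))"
    if "\<beta> * z2 + \<alpha> * z1 \<in> S" for z1 z2
    using deriv_cubic_along_line[OF r(1,2) that, of "\<delta> * z2" \<gamma>]
    by (simp add: partial1_def cubic_term_def add.commute)
  have p2: "partial2 ?q (z1, z2) =
      (\<alpha> * z1 + \<beta> * z2) * (\<delta> * (\<alpha> * z1 + \<beta> * z2) * r (\<alpha> * z1 + \<beta> * z2)
       + 2 * \<beta> * (\<gamma> * z1 + \<delta> * z2) * r (\<alpha> * z1 + \<beta> * z2)
       + \<beta> * (\<gamma> * z1 + \<delta> * z2) * (\<alpha> * z1 + \<beta> * z2) * deriv r (\<alpha> * z1 + \<beta> * z2))"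
    if "\<alpha> * z1 + \<beta> * z2 \<in> S" for z1 z2
    using deriv_cubic_along_line[OF r(1,2) that, of "\<gamma> * z1" \<delta>]
    by (simp add: partial2_def cubic_term_def)
  have zero: "deriv F 0 = 0"
    if "\<And>w. a * w \<in> S \<Longrightarrow> F w = (a * w) * (e1 * (a * w) * r (a * w) + e2 * (c * w) * r (a * w)
       + b * (c * w) * (a * w) * deriv r (a * w))" for F a b c e1 e2
  proof -
    have "deriv F 0 = deriv (\<lambda>w. (a * w) * (e1 * (a * w) * r (a * w) + e2 * (c * w) * r (a * w)
       + b * (c * w) * (a * w) * deriv r (a * w))) 0"
      by (rule deriv_cong_ev) (use near_0[of a] that in \<open>auto elim: eventually_mono\<close>)
    then show ?thesis
      using deriv_quadratic_along_line_0[OF r] by simp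
  qed
  have k_cases: "k \<in> {(0, 0), (1, 0), (0, 1), (2, 0), (1, 1), (0, 2)}"
    using k by (cases k) auto
  have "partial1 (partial1 ?q) (0, 0) = 0"
    using p1[of 0]
    by (simp add: partial1_def[of "partial1 ?q"])
       (rule zero[of \<alpha> _ \<gamma> "2 * \<alpha>" \<gamma> \<alpha>], simp)
  moreover have "partial1 (partial2 ?q) (0, 0) = 0"
    using p2[of _ 0]
    by (simp add: partial1_def[of "partial2 ?q"])
       (rule zero[of \<alpha> _ \<delta> "2 * \<beta>" \<gamma> \<beta>], simp)
  moreover have "partial2 (partial2 ?q) (0, 0) = 0"
    using p2[of 0]
    by (simp add: partial2_def[of "partial2 ?q"])
       (rule zero[of \<beta> _ \<delta> "2 * \<beta>" \<delta> \<beta>], simp)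
  moreover have "?q (0, 0) = 0" "partial1 ?q (0, 0) = 0" "partial2 ?q (0, 0) = 0"
    using p1[of 0 0] p2[of 0 0] r(3) by (auto simp: cubic_term_def)
  ultimately show ?thesis
    using k_cases by (auto simp: partial_deriv_def numeral_2_eq_2)
qed

section \<open>The extremal Moebius map\<close>

text \<open>After squaring, the terms with \<open>Re w\<close> cancel and the inequality becomes
  \<open>d (s\<^sup>2 \<bar>w\<bar>\<^sup>2) \<le> d (d\<^sup>2)\<close>.\<close>

lemma moebius_bound:
  fixes w :: complex and s d :: real
  assumes d: "d = 1 - s\<^sup>2" "0 \<le> d" and s: "0 \<le> s" and w: "s * cmod w \<le> d"
  shows "s * cmod (of_real d + w) \<le> cmod (of_real d + of_real (s\<^sup>2) * w)"
proof -
  have *: "(s * cmod w)\<^sup>2 \<le> d\<^sup>2"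
    using w s by (intro power_mono) auto
  have expand: "(cmod (of_real d + of_real c * w))\<^sup>2 = d\<^sup>2 + 2 * d * c * Re w + c\<^sup>2 * (cmod w)\<^sup>2" for c
    by (simp add: cmod_power2 power2_sum power_mult_distrib algebra_simps)
  have "(s * cmod (of_real d + w))\<^sup>2 = s\<^sup>2 * (d\<^sup>2 + 2 * d * Re w + (cmod w)\<^sup>2)"
    using expand[of 1] by (simp add: power_mult_distrib)
  also have "\<dots> \<le> d\<^sup>2 + 2 * d * s\<^sup>2 * Re w + s\<^sup>2 * s\<^sup>2 * (cmod w)\<^sup>2"
  proof -
    have "d * (s * cmod w)\<^sup>2 \<le> d * d\<^sup>2"
      using * d by (intro mult_left_mono) auto
    moreover have "d * x = x - s\<^sup>2 * x" for x
      by (simp add: d(1) algebra_simps)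
    ultimately have "(s * cmod w)\<^sup>2 - s\<^sup>2 * (s * cmod w)\<^sup>2 \<le> d\<^sup>2 - s\<^sup>2 * d\<^sup>2"
      by simp
    then show ?thesis
      by (simp add: power_mult_distrib algebra_simps)
  qed
  also have "\<dots> = (cmod (of_real d + of_real (s\<^sup>2) * w))\<^sup>2"
    unfolding expand by (simp add: power2_eq_square)
  finally show ?thesis
    by (rule power2_le_imp_le) auto
qed

lemma norm_linear_form_le:
  assumes "(z1, z2) \<in> bidisc"
  shows "cmod (a * z1 + b * z2) \<le> cmod a + cmod b"
proof -
  have "cmod z1 \<le> 1" "cmod z2 \<le> 1"
    using assms by (auto simp: bidisc_def)
  then have "cmod (a * z1) \<le> cmod a" "cmod (b * z2) \<le> cmod b"
    by (simp_all add: norm_mult mult_left_le)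
  then show ?thesis
    by (meson add_mono norm_triangle_le)
qed

text \<open>In the boundary case \<open>s = 1\<close> the formula for \<open>r\<close> degenerates to \<open>- 1 / w\<close>, but then
  \<open>t = 0\<close>, so that \<open>L\<^sub>2\<close> vanishes identically and \<open>p = L\<^sub>1\<close> needs no correction.\<close>

lemma moebius_correction_exists:
  fixes s t :: real
  assumes s: "0 \<le> s" and t: "0 \<le> t" and st: "s\<^sup>2 + s * t \<le> 1"
  obtains r S where "r holomorphic_on S" "open S" "cball 0 t \<subseteq> S"
    "\<And>w :: complex. cmod w \<le> t \<Longrightarrow> s * cmod (1 + w + w\<^sup>2 * r w) \<le> 1"
proof (cases "s = 1")
  case True
  with st t have "t = 0" by simp
  with True show ?thesis
    using that[of "\<lambda>_. 0" UNIV] by auto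
next
  case False
  define d where "d = 1 - s\<^sup>2"
  have "s\<^sup>2 \<le> 1"
    using st s t mult_nonneg_nonneg[of s t] by linarith
  then have "s < 1"
    using s False by (simp add: abs_square_le_1)
  then have d0: "0 < d"
    using s by (simp add: d_def power_less_one_iff)
  define S where "S = {w. of_real d + of_real (s\<^sup>2) * w \<noteq> (0 :: complex)}"
  define r where "r = (\<lambda>w :: complex. - of_real (s\<^sup>2) / (of_real d + of_real (s\<^sup>2) * w))"
  have small: "s * cmod w \<le> d" if "cmod w \<le> t" for w
    using mult_left_mono[OF that s] st by (simp add: d_def)
  \<comment> \<open>A zero of the denominator would satisfy \<open>s (s \<bar>w\<bar>) = d\<close>, while \<open>s \<bar>w\<bar> \<le> d\<close> and \<open>s < 1\<close>.\<close>
  have nz: "w \<in> S" if "cmod w \<le> t" for w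
    unfolding S_def
  proof (intro CollectI notI)
    assume "of_real d + of_real (s\<^sup>2) * w = (0 :: complex)"
    then have "of_real (s\<^sup>2) * w = - complex_of_real d"
      by (simp add: eq_neg_iff_add_eq_0 add.commute)
    then have "cmod (of_real (s\<^sup>2) * w) = d"
      using d0 by simp
    then have "s * (s * cmod w) = d"
      by (simp add: norm_mult norm_power power2_eq_square)
    moreover have "s * (s * cmod w) \<le> s * d"
      by (intro mult_left_mono small that s)
    moreover have "s * d < d"
      using \<open>s < 1\<close> d0 by simp
    ultimately show False by simp
  qed
  show ?thesis
  proof (rule that)
    show "r holomorphic_on S"
      unfolding r_def S_def by (intro holomorphic_intros) auto
    show "open S"
      unfolding S_def by (intro open_Collect_neq continuous_intros)
    show "cball 0 t \<subseteq> S"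
      using nz by auto
    show "s * cmod (1 + w + w\<^sup>2 * r w) \<le> 1" if "cmod w \<le> t" for w
    proof -
      have B: "of_real d + of_real (s\<^sup>2) * w \<noteq> (0 :: complex)"
        using nz[OF that] by (simp add: S_def)
      have "(1 + w) * (of_real d + of_real (s\<^sup>2) * w) - w\<^sup>2 * of_real (s\<^sup>2) = of_real d + w"
        by (simp add: d_def algebra_simps power2_eq_square)
      with B have "1 + w + w\<^sup>2 * r w = (of_real d + w) / (of_real d + of_real (s\<^sup>2) * w)"
        by (simp add: r_def eq_divide_eq left_diff_distrib)
      moreover have "s * cmod (of_real d + w) \<le> cmod (of_real d + of_real (s\<^sup>2) * w)"
        using d0 s small[OF that] by (intro moebius_bound) (simp_all add: d_def)
      ultimately show ?thesis
        using B by (simp add: norm_divide divide_le_eq_1)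
    qed
  qed
qed

section \<open>Aligning the coefficients\<close>

text \<open>Rotating \<open>b\<close> by the difference of the arguments makes it point in the direction of \<open>a\<close>.
  If \<open>a\<close> or \<open>b\<close> is zero its direction does not matter, whatever the value of \<open>Arg 0\<close>.\<close>

lemma norm_add_mult_cis_Arg:
  "cmod (a + b * cis (Arg a - Arg b)) = cmod a + cmod b"
proof -
  have "a + b * cis (Arg a - Arg b) = rcis (cmod a) (Arg a) + rcis (cmod b) (Arg b) * cis (Arg a - Arg b)"
    by (simp add: rcis_cmod_Arg)
  also have "\<dots> = of_real (cmod a + cmod b) * cis (Arg a)"
    by (simp add: rcis_def mult.assoc cis_mult distrib_right)
  finally show ?thesis
    by (simp add: norm_mult del: of_real_add)
qed

lemma norm_add_mult_unit:
  assumes "a * b = 0" "cmod z = 1"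
  shows "cmod (a + b * z) = cmod a + cmod b"
  using assms by (auto simp: norm_mult)

text \<open>A point that aligns one of the two pairs always exists. It also aligns the other pair, either
  because that pair contains a zero and every point does, or because the congruence makes the
  aligning points of both pairs equal.\<close>

lemma aligned_point_exists:
  assumes "\<alpha> * \<beta> * \<gamma> * \<delta> = 0 \<or> [Arg \<alpha> - Arg \<beta> = Arg \<gamma> - Arg \<delta>] (rmod (2 * pi))"
  obtains z where "cmod z = 1" "cmod (\<gamma> + \<delta> * z) = cmod \<gamma> + cmod \<delta>"
    "cmod (\<alpha> + \<beta> * z) = cmod \<alpha> + cmod \<beta>"
proof -
  consider "\<alpha> * \<beta> = 0" | "\<gamma> * \<delta> = 0" | "[Arg \<alpha> - Arg \<beta> = Arg \<gamma> - Arg \<delta>] (rmod (2 * pi))"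
    using assms by auto
  then show ?thesis
  proof cases
    case 1
    then show ?thesis
      using that[of "cis (Arg \<gamma> - Arg \<delta>)"] by (simp add: norm_add_mult_cis_Arg norm_add_mult_unit)
  next
    case 2
    then show ?thesis
      using that[of "cis (Arg \<alpha> - Arg \<beta>)"] by (simp add: norm_add_mult_cis_Arg norm_add_mult_unit)
  next
    case 3
    then have "cis (Arg \<alpha> - Arg \<beta>) = cis (Arg \<gamma> - Arg \<delta>)"
      by (simp add: cis_eq_iff)
    then show ?thesis
      using that[of "cis (Arg \<alpha> - Arg \<beta>)"] by (metis norm_add_mult_cis_Arg norm_cis)
  qed
qed

section \<open>The bounded extension of \<open>p\<close>\<close>

theorem theorem1p17:
  fixes \<alpha> \<beta> \<gamma> \<delta> :: complex
    and p1 p2 :: "complex \<Rightarrow> complex"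
    and p :: "complex \<times> complex \<Rightarrow> complex"
  assumes p1: "p1 = (\<lambda>z. \<gamma> + \<delta> * z)"
    and p2: "p2 = (\<lambda>z. (\<alpha> + \<beta> * z) * (\<gamma> + \<delta> * z))"
    and p: "p = (\<lambda>(z1, z2). \<gamma> * z1 + \<delta> * z2 + \<alpha> * \<gamma> * z1\<^sup>2
                  + (\<alpha> * \<delta> + \<beta> * \<gamma>) * z1 * z2 + \<beta> * \<delta> * z2\<^sup>2)"
    and bound: "\<forall>z\<in>sphere 0 1. (cmod (p1 z))\<^sup>2 + cmod (p2 z) \<le> 1"
    and args: "\<alpha> * \<beta> * \<gamma> * \<delta> = 0 \<or>
               [Arg \<alpha> - Arg \<beta> = Arg \<gamma> - Arg \<delta>] (rmod (2 * pi))"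
  shows "\<exists>q :: complex \<times> complex \<Rightarrow> complex.
           holomorphic2_on q bidisc \<and>
           (\<forall>k. fst k + snd k \<le> 2 \<longrightarrow> partial_deriv k q (0, 0) = 0) \<and>
           bidisc_sup_norm (\<lambda>z. p z + q z) \<le> 1"
proof -
  define s t where "s = cmod \<gamma> + cmod \<delta>" and "t = cmod \<alpha> + cmod \<beta>"
  have st0: "0 \<le> s" "0 \<le> t"
    by (simp_all add: s_def t_def)
  obtain z where z: "cmod z = 1" "cmod (\<gamma> + \<delta> * z) = s" "cmod (\<alpha> + \<beta> * z) = t"
    unfolding s_def t_def by (rule aligned_point_exists[OF args])
  then have "s\<^sup>2 + s * t \<le> 1"
    using bspec[OF bound, of z] by (simp add: p1 p2 norm_mult mult.commute)
  then obtain r S where r: "r holomorphic_on S" "open S" "cball 0 t \<subseteq> S"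
    and r_bound: "\<And>w :: complex. cmod w \<le> t \<Longrightarrow> s * cmod (1 + w + w\<^sup>2 * r w) \<le> 1"
    by (rule moebius_correction_exists[OF st0]) blast
  define q where "q = cubic_term \<alpha> \<beta> \<gamma> \<delta> r"
  have L2: "cmod (\<alpha> * z1 + \<beta> * z2) \<le> t" if "(z1, z2) \<in> bidisc" for z1 z2
    using norm_linear_form_le[OF that] by (simp add: t_def)
  have "holomorphic2_on q bidisc"
    unfolding q_def
    by (rule holomorphic2_on_cubic_term[OF r(1,2)]) (use L2 r(3) in auto)
  moreover have "partial_deriv k q (0, 0) = 0" if "fst k + snd k \<le> 2" for k
    unfolding q_def
    by (rule partial_deriv_cubic_term_0[OF r(1,2) _ that]) (use r(3) st0 in auto)
  moreover have "cmod (p (z1, z2) + q (z1, z2)) \<le> 1" if z: "(z1, z2) \<in> bidisc" for z1 z2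
  proof -
    define w where "w = \<alpha> * z1 + \<beta> * z2"
    have "p (z1, z2) + q (z1, z2) = (\<gamma> * z1 + \<delta> * z2) * (1 + w + w\<^sup>2 * r w)"
      by (simp add: p q_def cubic_term_def w_def algebra_simps power2_eq_square)
    then have "cmod (p (z1, z2) + q (z1, z2)) = cmod (\<gamma> * z1 + \<delta> * z2) * cmod (1 + w + w\<^sup>2 * r w)"
      by (simp only: norm_mult)
    also have "\<dots> \<le> s * cmod (1 + w + w\<^sup>2 * r w)"
      using norm_linear_form_le[OF z] by (intro mult_right_mono) (auto simp: s_def)
    also have "\<dots> \<le> 1"
      using r_bound L2[OF z] by (simp add: w_def)
    finally show ?thesis .
  qed
  then have "bidisc_sup_norm (\<lambda>z. p z + q z) \<le> 1"
    unfolding bidisc_sup_norm_def by (intro SUP_least) auto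
  ultimately show ?thesis
    by blast
qed

end
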